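(* Let $(\mathcal{P},\overline{E})$ be a radical curve parametrization with $\mathcal{P}=(p_1/q_1,\ldots,p_n/q_n)$. For each $i=1,\ldots,n$ let $F_i(x_i,t)$ be the generator of the ideal $I(\mathcal{A}_{\mathcal{P}})\cap\mathbb{C}[x_i,t]$, and let $c_{\alpha_i}(x_i)\in\mathbb{C}[x_i]$ be its leading coefficient with respect to $t$, that is, $F_i(x_i,t)=c_{\alpha_i}(x_i)t^{\alpha_i}+(\text{terms of lower degree in } t)$. If $\overline{x}=(x_1,\ldots,x_n)\in\overline{X(\mathcal{P})}$ cannot be lifted to $\mathcal{A}_{\mathcal{P}}$ (i.e. there is no $(t,\overline{\Delta})\in\mathbb{C}^{m+1}$ with $(t,\overline{\Delta},\overline{x})\in\mathcal{A}_{\mathcal{P}}$), then $c_{\alpha_1}(x_1)=\cdots=c_{\alpha_n}(x_n)=0$. In particular, there are at most $\deg(c_{\alpha_1})\cdots\deg(c_{\alpha_n})$ such points $\overline{x}$.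
   Context: **Radical curve parametrization.** Let $\mathbb{F}_0=\mathbb{C}(t)\subseteq\mathbb{F}_1\subseteq\cdots\subseteq\mathbb{F}_m$ be a radical tower: $\mathbb{F}_i=\mathbb{F}_{i-1}(\delta_i)$ with $\delta_i^{e_i}\in\mathbb{F}_{i-1}$, $e_i$ a positive integer. Write $\overline{\delta}=(\delta_1,\ldots,\delta_m)$ and $\overline{\Delta}=(\Delta_1,\ldots,\Delta_m)$ for corresponding variables. The defining polynomials of the $\delta_i$ are $E_i=\Delta_i^{e_i}-g_i(t,\Delta_1,\ldots,\Delta_{i-1})\in\mathbb{C}[t,\overline{\Delta}]$, where $g_i$ is a nonzero polynomial with $\deg_{\Delta_j}(g_i)<e_j$ for $j<i$, and $E_i(t,\overline{\delta})=0$. A radical curve parametrization is given by a tuple $\mathcal{P}(t,\overline{\Delta})=(p_1/q_1,\ldots,p_n/q_n)$ with $p_i,q_i\in\mathbb{C}[t,\overline{\Delta}]$, $q_i(t,\overline{\delta})\neq 0$, together with $\overline{E}=(E_1,\ldots,E_m)$, where the elements $x_i=p_i(t,\overline{\delta})/q_i(t,\overline{\delta})\in\mathbb{F}_m$ are not all constant (the Jacobian with respect to $t$ has rank one). **The sets involved.** $X(\mathcal{P})\subseteq\mathbb{C}^n$ is the set of all $\overline{x}\in\mathbb{C}^n$ for which there is $(t,\overline{\Delta})\in\mathbb{C}^{m+1}$ with $E_i(t,\overline{\Delta})=0$ for all $i$, $\mathcal{P}(t,\overline{\Delta})$ well defined (all $q_i(t,\overline{\Delta})\ne0$) and $\mathcal{P}(t,\overline{\Delta})=\overline{x}$;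 $\overline{X(\mathcal{P})}$ is its Zariski closure in $\mathbb{C}^n$. $\mathcal{D}_{\mathcal{P}}\subseteq\mathbb{C}^{m+n+2}$ is the algebraic set of points $(t,\overline{\Delta},\overline{x},z)$ satisfying $E_i(t,\overline{\Delta})=0$ ($i=1,\ldots,m$), $p_i(t,\overline{\Delta})-x_iq_i(t,\overline{\Delta})=0$ ($i=1,\ldots,n$), and $z\cdot\mathrm{lcm}(q_1,\ldots,q_n)(t,\overline{\Delta})-1=0$. $\mathcal{A}_{\mathcal{P}}\subseteq\mathbb{C}^{m+n+1}$ is the Zariski closure of the image of $\mathcal{D}_{\mathcal{P}}$ under $(t,\overline{\Delta},\overline{x},z)\mapsto(t,\overline{\Delta},\overline{x})$. $I(\mathcal{A}_{\mathcal{P}})\subseteq\mathbb{C}[t,\overline{\Delta},\overline{x}]$ is the ideal of polynomials vanishing on $\mathcal{A}_{\mathcal{P}}$; the ideals $I(\mathcal{A}_{\mathcal{P}})\cap\mathbb{C}[x_i,t]$ are nonzero principal ideals. *)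

theory Defs
  imports
    Complex_Main
    "HOL.Hull"
    "HOL-Library.FuncSet"
    "HOL-Library.Poly_Mapping"
    "HOL-Computational_Algebra.Polynomial"
    "HOL-Computational_Algebra.Fraction_Field"
begin

section \<open>Polynomials and affine space over named variables\<close>

text \<open>
  The variables are \<open>t\<close>, \<open>\<Delta>\<^sub>1, \<Delta>\<^sub>2, \<dots>\<close>, \<open>x\<^sub>1, x\<^sub>2, \<dots>\<close> and \<open>z\<close>. All polynomial rings are subrings
  of one ring \<open>mpoly\<close>, singled out by the variables allowed to occur. The affine space with
  coordinates in a finite set \<open>V\<close> of variables is the set of extensional functions on \<open>V\<close>,
  so that distinct functions are distinct points and projections are restrictions.
\<close>

datatype pvar = TV | DV nat | XV nat | ZV

type_synonym mpoly = "(pvar \<Rightarrow>\<^sub>0 nat) \<Rightarrow>\<^sub>0 complex"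

definition Var :: "pvar \<Rightarrow> mpoly" where
  "Var v = Poly_Mapping.single (Poly_Mapping.single v 1) 1"

definition poly_ring :: "pvar set \<Rightarrow> mpoly set" where
  "poly_ring V = {f. \<forall>mon \<in> Poly_Mapping.keys f. Poly_Mapping.keys mon \<subseteq> V}"

definition degree_in :: "pvar \<Rightarrow> mpoly \<Rightarrow> nat" where
  "degree_in v f = Max (insert 0 ((\<lambda>mon. Poly_Mapping.lookup mon v) ` Poly_Mapping.keys f))"

definition eval_via :: "(complex \<Rightarrow> 'k::comm_ring_1) \<Rightarrow> (pvar \<Rightarrow> 'k) \<Rightarrow> mpoly \<Rightarrow> 'k" where
  "eval_via h a f =
     (\<Sum>mon \<in> Poly_Mapping.keys f.
        h (Poly_Mapping.lookup f mon) *
        (\<Prod>v \<in> Poly_Mapping.keys mon. a v ^ Poly_Mapping.lookup mon v))"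

abbreviation eval_at :: "(pvar \<Rightarrow> complex) \<Rightarrow> mpoly \<Rightarrow> complex" where
  "eval_at \<equiv> eval_via (\<lambda>c. c)"

definition affine_space :: "pvar set \<Rightarrow> (pvar \<Rightarrow> complex) set" where
  "affine_space V = V \<rightarrow>\<^sub>E UNIV"

definition zariski_closed :: "pvar set \<Rightarrow> (pvar \<Rightarrow> complex) set \<Rightarrow> bool" where
  "zariski_closed V S \<longleftrightarrow>
     (\<exists>P \<subseteq> poly_ring V. S = {a \<in> affine_space V. \<forall>f \<in> P. eval_at a f = 0})"

definition zariski_closure :: "pvar set \<Rightarrow> (pvar \<Rightarrow> complex) set \<Rightarrow> (pvar \<Rightarrow> complex) set" where
  "zariski_closure V S = zariski_closed V hull S"

definition vanishing_ideal :: "pvar set \<Rightarrow> (pvar \<Rightarrow> complex) set \<Rightarrow> mpoly set" where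
  "vanishing_ideal V S = {f \<in> poly_ring V. \<forall>a \<in> S. eval_at a f = 0}"

definition is_lcm :: "pvar set \<Rightarrow> mpoly \<Rightarrow> mpoly set \<Rightarrow> bool" where
  "is_lcm V L Q \<longleftrightarrow>
     L \<in> poly_ring V \<and> (\<forall>f \<in> Q. f dvd L) \<and>
     (\<forall>M \<in> poly_ring V. (\<forall>f \<in> Q. f dvd M) \<longrightarrow> L dvd M)"

definition td_vars :: "nat \<Rightarrow> pvar set" where
  "td_vars m = insert TV (DV ` {1..m})"

definition x_vars :: "nat \<Rightarrow> pvar set" where
  "x_vars n = XV ` {1..n}"

section \<open>Radical towers and radical curve parametrizations\<close>

definition is_ring_hom :: "('a::comm_ring_1 \<Rightarrow> 'b::comm_ring_1) \<Rightarrow> bool" where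
  "is_ring_hom h \<longleftrightarrow> h 1 = 1 \<and> (\<forall>a b. h (a + b) = h a + h b \<and> h (a * b) = h a * h b)"

definition is_subfield :: "'k::field set \<Rightarrow> bool" where
  "is_subfield S \<longleftrightarrow>
     0 \<in> S \<and> 1 \<in> S \<and> (\<forall>a \<in> S. \<forall>b \<in> S. a - b \<in> S \<and> a * b \<in> S) \<and> (\<forall>a \<in> S. inverse a \<in> S)"

text \<open>
  The tower lives in a field \<open>'k\<close> together with an embedding \<open>\<iota>\<close> of \<open>\<complex>(t)\<close>; \<open>tower \<iota> \<delta> i\<close> is \<open>\<F>\<^sub>i\<close>.
\<close>

fun tower :: "(complex poly fract \<Rightarrow> 'k::field) \<Rightarrow> (nat \<Rightarrow> 'k) \<Rightarrow> nat \<Rightarrow> 'k set" where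
  "tower \<iota> \<delta> 0 = range \<iota>"
| "tower \<iota> \<delta> (Suc i) = is_subfield hull (insert (\<delta> (Suc i)) (tower \<iota> \<delta> i))"

definition const_emb :: "(complex poly fract \<Rightarrow> 'k::field) \<Rightarrow> complex \<Rightarrow> 'k" where
  "const_emb \<iota> c = \<iota> (Fract [:c:] 1)"

text \<open>
  \<open>eval_delta \<iota> \<delta> f\<close> is \<open>f(t, \<delta>\<^sub>1, \<dots>, \<delta>\<^sub>m)\<close>, for \<open>f\<close> in \<open>\<complex>[t, \<Delta>\<^sub>1, \<dots>, \<Delta>\<^sub>m]\<close>; the values given
  to the other variables are irrelevant.
\<close>

definition eval_delta :: "(complex poly fract \<Rightarrow> 'k::field) \<Rightarrow> (nat \<Rightarrow> 'k) \<Rightarrow> mpoly \<Rightarrow> 'k" where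
  "eval_delta \<iota> \<delta> =
     eval_via (const_emb \<iota>)
       (\<lambda>v. case v of TV \<Rightarrow> \<iota> (Fract [:0, 1:] 1) | DV i \<Rightarrow> \<delta> i | _ \<Rightarrow> 0)"

definition radical_tower ::
  "(complex poly fract \<Rightarrow> 'k::field) \<Rightarrow> nat \<Rightarrow> (nat \<Rightarrow> nat) \<Rightarrow> (nat \<Rightarrow> 'k) \<Rightarrow> bool" where
  "radical_tower \<iota> m e \<delta> \<longleftrightarrow>
     is_ring_hom \<iota> \<and> (\<forall>i \<in> {1..m}. e i > 0 \<and> \<delta> i ^ e i \<in> tower \<iota> \<delta> (i - 1))"

definition defining_polys ::
  "(complex poly fract \<Rightarrow> 'k::field) \<Rightarrow> nat \<Rightarrow> (nat \<Rightarrow> nat) \<Rightarrow> (nat \<Rightarrow> 'k) \<Rightarrow> (nat \<Rightarrow> mpoly) \<Rightarrow> bool"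
where
  "defining_polys \<iota> m e \<delta> E \<longleftrightarrow>
     (\<forall>i \<in> {1..m}.
        (\<exists>g \<in> poly_ring (td_vars (i - 1)).
           g \<noteq> 0 \<and> (\<forall>j \<in> {1..<i}. degree_in (DV j) g < e j) \<and> E i = Var (DV i) ^ e i - g) \<and>
        eval_delta \<iota> \<delta> (E i) = 0)"

text \<open>
  The last conjunct says that the elements \<open>x\<^sub>i = p\<^sub>i(t, \<delta>) / q\<^sub>i(t, \<delta>)\<close> are not all constant.
\<close>

definition radical_curve_parametrization ::
  "(complex poly fract \<Rightarrow> 'k::field) \<Rightarrow> nat \<Rightarrow> (nat \<Rightarrow> 'k) \<Rightarrow> (nat \<Rightarrow> mpoly) \<Rightarrow>
   nat \<Rightarrow> (nat \<Rightarrow> mpoly) \<Rightarrow> (nat \<Rightarrow> mpoly) \<Rightarrow> bool"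
where
  "radical_curve_parametrization \<iota> m \<delta> E n p q \<longleftrightarrow>
     (\<exists>e. radical_tower \<iota> m e \<delta> \<and> defining_polys \<iota> m e \<delta> E) \<and>
     (\<forall>i \<in> {1..n}. p i \<in> poly_ring (td_vars m) \<and> q i \<in> poly_ring (td_vars m) \<and>
        eval_delta \<iota> \<delta> (q i) \<noteq> 0) \<and>
     (\<exists>i \<in> {1..n}. eval_delta \<iota> \<delta> (p i) / eval_delta \<iota> \<delta> (q i) \<notin> range (const_emb \<iota>))"

section \<open>The associated sets\<close>

definition X_set ::
  "nat \<Rightarrow> (nat \<Rightarrow> mpoly) \<Rightarrow> nat \<Rightarrow> (nat \<Rightarrow> mpoly) \<Rightarrow> (nat \<Rightarrow> mpoly) \<Rightarrow> (pvar \<Rightarrow> complex) set"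
where
  "X_set m E n p q =
     {x \<in> affine_space (x_vars n).
        \<exists>a \<in> affine_space (td_vars m).
          (\<forall>i \<in> {1..m}. eval_at a (E i) = 0) \<and>
          (\<forall>i \<in> {1..n}. eval_at a (q i) \<noteq> 0) \<and>
          (\<forall>i \<in> {1..n}. eval_at a (p i) / eval_at a (q i) = x (XV i))}"

text \<open>
  \<open>L\<close> stands for a least common multiple of \<open>q\<^sub>1, \<dots>, q\<^sub>n\<close>, which is unique only up to a unit.
\<close>

definition D_set ::
  "nat \<Rightarrow> (nat \<Rightarrow> mpoly) \<Rightarrow> nat \<Rightarrow> (nat \<Rightarrow> mpoly) \<Rightarrow> (nat \<Rightarrow> mpoly) \<Rightarrow> mpoly \<Rightarrow> (pvar \<Rightarrow> complex) set"
where
  "D_set m E n p q L =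
     {a \<in> affine_space (td_vars m \<union> x_vars n \<union> {ZV}).
        (\<forall>i \<in> {1..m}. eval_at a (E i) = 0) \<and>
        (\<forall>i \<in> {1..n}. eval_at a (p i) - a (XV i) * eval_at a (q i) = 0) \<and>
        a ZV * eval_at a L - 1 = 0}"

definition A_set ::
  "nat \<Rightarrow> (nat \<Rightarrow> mpoly) \<Rightarrow> nat \<Rightarrow> (nat \<Rightarrow> mpoly) \<Rightarrow> (nat \<Rightarrow> mpoly) \<Rightarrow> mpoly \<Rightarrow> (pvar \<Rightarrow> complex) set"
where
  "A_set m E n p q L =
     zariski_closure (td_vars m \<union> x_vars n)
       ((\<lambda>a. restrict a (td_vars m \<union> x_vars n)) ` D_set m E n p q L)"

definition liftable :: "nat \<Rightarrow> (pvar \<Rightarrow> complex) set \<Rightarrow> (pvar \<Rightarrow> complex) \<Rightarrow> bool" where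
  "liftable n A x \<longleftrightarrow> (\<exists>a \<in> A. restrict a (x_vars n) = x)"

text \<open>
  \<open>\<complex>[x\<^sub>i, t]\<close> is read as \<open>\<complex>[x\<^sub>i][t]\<close>: the outer variable of a \<open>complex poly poly\<close> is \<open>t\<close> and the
  inner one is \<open>x\<^sub>i\<close>, so \<open>lead_coeff\<close> is the leading coefficient with respect to \<open>t\<close>.
\<close>

definition xt_poly :: "nat \<Rightarrow> complex poly poly \<Rightarrow> mpoly" where
  "xt_poly i G =
     (\<Sum>k \<le> degree G. \<Sum>l \<le> degree (coeff G k).
        Poly_Mapping.single (Poly_Mapping.single TV k + Poly_Mapping.single (XV i) l)
          (coeff (coeff G k) l))"

definition elim_ideal :: "nat \<Rightarrow> mpoly set \<Rightarrow> complex poly poly set" where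
  "elim_ideal i J = {G. xt_poly i G \<in> J}"

end

(*
  A point x of the closure of X(P) kills I(A) \<inter> C[x]. If the leading coefficient of F_i does not vanish
  at x_i, the classical extension theorem lifts x to a common zero of I(A) \<inter> C[x, t]; since E_1, ..., E_m
  are monic in Delta_1, ..., Delta_m, it lifts further, one variable at a time, to a zero of I(A), that
  is, to a point of A. The nonliftable points are therefore common zeros of the c_{alpha_i}(x_i), and
  these are nonzero polynomials because every x_i is algebraic over C(t) on the variety E = 0, q_i \<noteq> 0.
*)

theory Submission
  imports Defs "HOL-Computational_Algebra.Fundamental_Theorem_Algebra"
begin

section \<open>Subrings and ring homomorphisms\<close>

text \<open>The variety E = 0 may be reducible, as for Delta^2 = t^2, and q_i may vanish on a whole
  component. An identity in the field F_m speaks of one component only, whereas the equation for x_i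
  must hold at every point of D. It is therefore derived pointwise: since each E_i is monic, the
  functions on E = 0 are finitely generated over C[t], and a dimension count yields a relation that
  holds on all of E = 0; the variable z keeps q_i away from 0. For the extension step a zero of F_i
  alone is not enough; a common zero of the whole ideal I(A), specialized at x, is required. C[t] is
  a principal ideal domain, so the only obstruction is a nonzero constant in the specialized ideal.
  Elimination against F_i would turn such a constant into an element of I(A) in the variables x
  alone that does not vanish at x. The element F_i only has to keep its degree in t at x, so a
  single index i with nonzero c_{alpha_i}(x_i) suffices for a lift. This is why all of these values
  vanish at a nonliftable point.\<close>

definition is_subring :: "'a::comm_ring_1 set \<Rightarrow> bool" where
  "is_subring S \<longleftrightarrow> 1 \<in> S \<and> (\<forall>a \<in> S. \<forall>b \<in> S. a - b \<in> S \<and> a * b \<in> S)"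

text \<open>The rings C[V] are subsets of the one type \<open>mpoly\<close>, so C[V][v] has to be a
  set too: polynomials over the big ring with restricted coefficients.\<close>

definition polys_over :: "'a::comm_ring_1 set \<Rightarrow> 'a poly set" where
  "polys_over S = {G. \<forall>k. coeff G k \<in> S}"

lemma is_subringD:
  assumes "is_subring S"
  shows "0 \<in> S" "1 \<in> S" "a \<in> S \<Longrightarrow> b \<in> S \<Longrightarrow> a + b \<in> S" "a \<in> S \<Longrightarrow> b \<in> S \<Longrightarrow> a * b \<in> S"
    "a \<in> S \<Longrightarrow> - a \<in> S" "a \<in> S \<Longrightarrow> a ^ k \<in> S"
proof -
  show 1: "1 \<in> S" and m: "a \<in> S \<Longrightarrow> b \<in> S \<Longrightarrow> a * b \<in> S" for a b
    using assms by (auto simp: is_subring_def)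
  have d: "a \<in> S \<Longrightarrow> b \<in> S \<Longrightarrow> a - b \<in> S" for a b
    using assms by (auto simp: is_subring_def)
  show 0: "0 \<in> S" using d[OF 1 1] by simp
  show n: "a \<in> S \<Longrightarrow> - a \<in> S" for a using d[OF 0, of a] by simp
  show "a \<in> S \<Longrightarrow> b \<in> S \<Longrightarrow> a + b \<in> S" using d[of a "- b"] n[of b] by simp
  show "a \<in> S \<Longrightarrow> a ^ k \<in> S" by (induction k) (auto intro: 1 m)
qed

lemma subring_sum:
  assumes "is_subring S" "\<And>i. i \<in> I \<Longrightarrow> f i \<in> S"
  shows "sum f I \<in> S"
  using assms(2) by (induction I rule: infinite_finite_induct) (auto intro: is_subringD[OF assms(1)])

lemma subring_prod:
  assumes "is_subring S" "\<And>i. i \<in> I \<Longrightarrow> f i \<in> S"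
  shows "prod f I \<in> S"
  using assms(2) by (induction I rule: infinite_finite_induct) (auto intro: is_subringD[OF assms(1)])

lemma is_subring_polys_over:
  assumes "is_subring S"
  shows "is_subring (polys_over S)"
  unfolding is_subring_def[of "polys_over S"]
proof (intro conjI ballI)
  show "1 \<in> polys_over S"
    by (auto simp: polys_over_def coeff_1 intro: is_subringD[OF assms])
next
  fix f g assume "f \<in> polys_over S" "g \<in> polys_over S"
  then show "f - g \<in> polys_over S" "f * g \<in> polys_over S"
    using assms
    by (auto simp: polys_over_def coeff_mult is_subring_def
        intro!: subring_sum intro: is_subringD[OF assms])
qed

lemma const_in_polys_over:
  assumes "is_subring S" "c \<in> S"
  shows "[:c:] \<in> polys_over S"
  using assms is_subringD(1)[OF assms(1)] by (auto simp: polys_over_def coeff_pCons split: nat.splits)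

lemma monom_in_polys_over:
  assumes "is_subring S" "c \<in> S"
  shows "monom c k \<in> polys_over S"
  using assms is_subringD(1)[OF assms(1)] by (auto simp: polys_over_def)

lemma ring_homD:
  assumes "is_ring_hom h"
  shows "h 0 = 0" "h 1 = 1" "h (a + b) = h a + h b" "h (a * b) = h a * h b"
    "h (- a) = - h a" "h (a - b) = h a - h b" "h (a ^ k) = h a ^ k"
proof -
  show 1: "h 1 = 1" and p: "h (a + b) = h a + h b" and m: "h (a * b) = h a * h b" for a b
    using assms by (auto simp: is_ring_hom_def)
  show 0: "h 0 = 0" using p[of 0 0] by simp
  show n: "h (- a) = - h a" for a using p[of a "- a"] 0 by (simp add: add_eq_0_iff)
  show "h (a - b) = h a - h b" using p[of a "- b"] n by simp
  show "h (a ^ k) = h a ^ k" by (induction k) (auto simp: 1 m)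
qed

lemma ring_hom_sum:
  assumes "is_ring_hom h"
  shows "h (sum f I) = (\<Sum>i \<in> I. h (f i))"
  by (induction I rule: infinite_finite_induct) (auto simp: ring_homD[OF assms])

lemma ring_hom_prod:
  assumes "is_ring_hom h"
  shows "h (prod f I) = (\<Prod>i \<in> I. h (f i))"
  by (induction I rule: infinite_finite_induct) (auto simp: ring_homD[OF assms])

lemma is_ring_hom_map_poly:
  assumes "is_ring_hom h"
  shows "is_ring_hom (map_poly h)"
  unfolding is_ring_hom_def[of "map_poly h"]
  by (auto intro!: poly_eqI simp: coeff_map_poly coeff_mult ring_hom_sum[OF assms]
      ring_homD[OF assms])

lemma ring_hom_poly:
  assumes "is_ring_hom h"
  shows "h (poly G c) = poly (map_poly h G) (h c)"
  by (induction G) (auto simp: ring_homD[OF assms] map_poly_pCons)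

section \<open>The extension theorem\<close>

text \<open>
  Pivoting on the entry of \<open>h K\<close> in degree \<open>K\<close> kills the coefficients of degree \<open>K\<close> of the other \<open>h j\<close>
  and multiplies their images under \<open>\<phi>\<close> by a nonzero constant.
\<close>
lemma triangular_family_has_constant:
  fixes \<phi> :: "'r::comm_ring_1 \<Rightarrow> 'k::field"
  assumes S: "is_subring S" and \<phi>: "is_ring_hom \<phi>"
    and H_add: "\<And>f g. f \<in> H \<Longrightarrow> g \<in> H \<Longrightarrow> f + g \<in> H"
    and H_mult: "\<And>f g. f \<in> polys_over S \<Longrightarrow> g \<in> H \<Longrightarrow> f * g \<in> H"
    and H_sub: "H \<subseteq> polys_over S"
    and h: "\<And>j. j \<le> K \<Longrightarrow> h j \<in> H \<and> degree (h j) \<le> K \<and> \<phi> (coeff (h j) j) \<noteq> 0 \<and>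
              (\<forall>k > j. \<phi> (coeff (h j) k) = 0)"
  shows "\<exists>r. [:r:] \<in> H \<and> \<phi> r \<noteq> 0"
  using h
proof (induction K arbitrary: h)
  case 0
  then have "h 0 \<in> H" "degree (h 0) = 0" "\<phi> (coeff (h 0) 0) \<noteq> 0" by auto
  then show ?case by (metis degree_eq_zeroE coeff_pCons_0)
next
  case (Suc K)
  define u where "u = coeff (h (Suc K)) (Suc K)"
  define c where "c j = coeff (h j) (Suc K)" for j
  define h' where "h' j = [:u:] * h j + [:- c j:] * h (Suc K)" for j
  have S_coeff: "coeff (h j) k \<in> S" if "j \<le> Suc K" for j k
    using Suc.prems[OF that] H_sub by (auto simp: polys_over_def)
  have "h' j \<in> H \<and> degree (h' j) \<le> K \<and> \<phi> (coeff (h' j) j) \<noteq> 0 \<and>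
              (\<forall>k > j. \<phi> (coeff (h' j) k) = 0)" if j: "j \<le> K" for j
  proof -
    have hj: "h j \<in> H" "degree (h j) \<le> Suc K" "\<phi> (coeff (h j) j) \<noteq> 0"
      "\<forall>k > j. \<phi> (coeff (h j) k) = 0" using Suc.prems[of j] j by auto
    have hK: "h (Suc K) \<in> H" "degree (h (Suc K)) \<le> Suc K" "\<phi> u \<noteq> 0"
      using Suc.prems[of "Suc K"] by (auto simp: u_def)
    have cj: "\<phi> (c j) = 0" using hj(4) j by (auto simp: c_def)
    have "u \<in> S" "c j \<in> S" using S_coeff j by (auto simp: u_def c_def)
    then have "h' j \<in> H" unfolding h'_def
      by (intro H_add H_mult hj hK const_in_polys_over S is_subringD(5)[OF S])
    moreover have "coeff (h' j) k = 0" if "k > K" for k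
    proof (cases "k = Suc K")
      case True
      then show ?thesis by (simp add: h'_def u_def c_def mult.commute)
    next
      case False
      then have "k > Suc K" using that by simp
      then show ?thesis using hj(2) hK(2) by (simp add: h'_def coeff_eq_0)
    qed
    then have "degree (h' j) \<le> K" by (intro degree_le) auto
    moreover have "\<phi> (coeff (h' j) k) = \<phi> u * \<phi> (coeff (h j) k)" for k
      by (simp add: h'_def ring_homD[OF \<phi>] cj)
    ultimately show ?thesis using hj hK by auto
  qed
  then show ?case by (rule Suc.IH)
qed

text \<open>This is the Nullstellensatz in one variable: a nonzero element of least degree divides
  all the others, and it has a root because it is not constant.\<close>

lemma complex_poly_ideal_common_root:
  fixes J :: "complex poly set"
  assumes add: "\<And>f g. f \<in> J \<Longrightarrow> g \<in> J \<Longrightarrow> f + g \<in> J"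
    and mult: "\<And>f g. g \<in> J \<Longrightarrow> f * g \<in> J"
    and proper: "\<And>c. [:c:] \<in> J \<Longrightarrow> c = 0"
  shows "\<exists>b. \<forall>f \<in> J. poly f b = 0"
proof (cases "J \<subseteq> {0}")
  case True
  then show ?thesis by (metis poly_0 singletonD subsetD)
next
  case False
  then obtain f0 where "f0 \<in> J \<and> f0 \<noteq> 0" by auto
  then obtain P where P: "P \<in> J" "P \<noteq> 0" and least: "\<And>f. f \<in> J \<Longrightarrow> degree f < degree P \<Longrightarrow> f = 0"
    using ex_has_least_nat[of "\<lambda>f. f \<in> J \<and> f \<noteq> 0" f0 degree]
    by (metis not_le)
  have dvd: "P dvd f" if "f \<in> J" for f
  proof -
    have "f mod P = f + (- (f div P)) * P" by (simp add: minus_div_mult_eq_mod [symmetric])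
    also have "\<dots> \<in> J" using that P by (intro add mult)
    finally have "f mod P = 0"
      using least degree_mod_less[OF P(2), of f] by blast
    then show ?thesis by auto
  qed
  have "degree P \<noteq> 0" using proper P by (metis degree_eq_zeroE pCons_0_0)
  then have "\<not> constant (poly P)" by (simp add: constant_degree)
  then obtain b where "poly P b = 0" using fundamental_theorem_of_algebra by blast
  then have "poly f b = 0" if "f \<in> J" for f using dvd[OF that] by (auto elim!: dvdE)
  then show ?thesis by blast
qed

text \<open>
  If the specialization of \<open>H\<close> contained a nonzero constant, say the image of \<open>g\<close>, then the
  multiples \<open>g, Y g, Y\<^sup>2 g, \<dots>, f, Y f, Y\<^sup>2 f, \<dots>\<close> (the rows of the Sylvester matrix of \<open>f\<close> and \<open>g\<close>)
  would specialize to polynomials of degrees \<open>0, 1, 2, \<dots>\<close>.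
\<close>
theorem extension_theorem:
  fixes \<phi> :: "'r::comm_ring_1 \<Rightarrow> complex"
  assumes S: "is_subring S" and \<phi>: "is_ring_hom \<phi>" and surj: "\<phi> ` S = UNIV"
    and H_add: "\<And>f g. f \<in> H \<Longrightarrow> g \<in> H \<Longrightarrow> f + g \<in> H"
    and H_mult: "\<And>f g. f \<in> polys_over S \<Longrightarrow> g \<in> H \<Longrightarrow> f * g \<in> H"
    and H_sub: "H \<subseteq> polys_over S"
    and vanish: "\<And>r. [:r:] \<in> H \<Longrightarrow> \<phi> r = 0"
    and f: "f \<in> H" "\<phi> (lead_coeff f) \<noteq> 0"
  shows "\<exists>b. \<forall>G \<in> H. poly (map_poly \<phi> G) b = 0"
proof -
  note \<phi>_simps = ring_homD[OF \<phi>] coeff_map_poly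
  note hom = ring_homD[OF is_ring_hom_map_poly[OF \<phi>]]
  \<comment> \<open>Surjectivity of \<open>\<phi>\<close> on \<open>S\<close> is what makes the
    image of \<open>H\<close> an ideal of the full ring C[Y].\<close>
  have lift: "\<exists>f' \<in> polys_over S. map_poly \<phi> f' = f" for f
  proof -
    have "\<forall>c. \<exists>r. r \<in> S \<and> \<phi> r = c" using surj by (metis UNIV_I imageE)
    then obtain s where s: "\<And>c. s c \<in> S" "\<And>c. \<phi> (s c) = c" by metis
    define f' where "f' = (\<Sum>k \<le> degree f. monom (s (coeff f k)) k)"
    have "f' \<in> polys_over S" unfolding f'_def
      by (intro subring_sum is_subring_polys_over S monom_in_polys_over s)
    moreover have "map_poly \<phi> f' = f"
      by (simp add: f'_def ring_hom_sum[OF is_ring_hom_map_poly[OF \<phi>]] map_poly_monom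
          ring_homD(1)[OF \<phi>] s poly_as_sum_of_monoms)
    ultimately show ?thesis by blast
  qed
  have "\<exists>b. \<forall>f \<in> map_poly \<phi> ` H. poly f b = 0"
  proof (rule complex_poly_ideal_common_root)
    fix f g assume "f \<in> map_poly \<phi> ` H" "g \<in> map_poly \<phi> ` H"
    then show "f + g \<in> map_poly \<phi> ` H" using H_add by (auto simp: hom(3)[symmetric])
  next
    fix f g assume "g \<in> map_poly \<phi> ` H"
    then obtain g' where "g = map_poly \<phi> g'" "g' \<in> H" by auto
    moreover obtain f' where "f = map_poly \<phi> f'" "f' \<in> polys_over S" using lift by metis
    ultimately have "f * g = map_poly \<phi> (f' * g')" "f' * g' \<in> H" using H_mult by (auto simp: hom)
    then show "f * g \<in> map_poly \<phi> ` H" by auto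
  next
    fix c assume "[:c:] \<in> map_poly \<phi> ` H"
    then obtain g where g: "g \<in> H" "map_poly \<phi> g = [:c:]" by auto
    show "c = 0"
    proof (rule ccontr)
      assume "c \<noteq> 0"
      have g_coeff: "\<phi> (coeff g k) = (if k = 0 then c else 0)" for k
        using arg_cong[OF g(2), of "\<lambda>p. coeff p k"] by (auto simp: \<phi>_simps coeff_pCons split: nat.splits)
      define d where "d = degree f"
      \<comment> \<open>Under \<open>\<phi>\<close> the polynomial \<open>g\<close> becomes the
        constant \<open>c\<close> and \<open>f\<close> keeps its degree \<open>d\<close>, so
        \<open>h j\<close> specializes to degree exactly \<open>j\<close> in both cases. Before
        specialization all degrees are at most \<open>d + degree g\<close>, which gives a square
        triangular family.\<close>
      define h where "h j = (if j < d then monom 1 j * g else monom 1 (j - d) * f)" for j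
      have "\<exists>r. [:r:] \<in> H \<and> \<phi> r \<noteq> 0"
      proof (rule triangular_family_has_constant[OF S \<phi> H_add H_mult H_sub])
        fix j assume j: "j \<le> d + degree g"
        have "h j \<in> H"
          unfolding h_def using f g by (auto intro!: H_mult monom_in_polys_over S is_subringD[OF S])
        moreover have "degree (h j) \<le> d + degree g"
        proof (cases "j < d")
          case True
          have "degree (monom 1 j * g) \<le> degree (monom (1::'r) j) + degree g" by (rule degree_mult_le)
          then show ?thesis using True degree_monom_le[of "1::'r" j] by (auto simp: h_def)
        next
          case False
          have "degree (monom 1 (j - d) * f) \<le> degree (monom (1::'r) (j - d)) + degree f"
            by (rule degree_mult_le)
          then show ?thesis using False j degree_monom_le[of "1::'r" "j - d"] by (auto simp: h_def d_def)
        qed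
        moreover have "\<phi> (coeff (h j) j) \<noteq> 0" "\<forall>k > j. \<phi> (coeff (h j) k) = 0"
          using f(2) \<open>c \<noteq> 0\<close>
          by (auto simp: h_def coeff_monom_mult g_coeff d_def \<phi>_simps coeff_eq_0 not_less)
        ultimately show "h j \<in> H \<and> degree (h j) \<le> d + degree g \<and> \<phi> (coeff (h j) j) \<noteq> 0 \<and>
              (\<forall>k > j. \<phi> (coeff (h j) k) = 0)" by blast
      qed
      then show False using vanish by blast
    qed
  qed
  then show ?thesis by auto
qed


section \<open>Evaluation of polynomials in named variables\<close>

lemma poly_ring_UNIV: "poly_ring UNIV = UNIV"
  by (auto simp: poly_ring_def)

lemma poly_ring_mono: "V \<subseteq> W \<Longrightarrow> poly_ring V \<subseteq> poly_ring W"
  by (auto simp: poly_ring_def)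

lemma single_in_poly_ring: "Poly_Mapping.keys mon \<subseteq> V \<Longrightarrow> Poly_Mapping.single mon c \<in> poly_ring V"
  by (auto simp: poly_ring_def split: if_splits)

lemma is_subring_poly_ring: "is_subring (poly_ring V)"
  unfolding is_subring_def
proof (intro conjI ballI)
  show "1 \<in> poly_ring V" by (auto simp: poly_ring_def)
next
  fix f g assume f: "f \<in> poly_ring V" and g: "g \<in> poly_ring V"
  have "Poly_Mapping.keys (f - g) \<subseteq> Poly_Mapping.keys f \<union> Poly_Mapping.keys g"
    by (auto simp: in_keys_iff lookup_minus)
  then show "f - g \<in> poly_ring V" using f g by (auto simp: poly_ring_def)
  show "f * g \<in> poly_ring V" unfolding poly_ring_def
  proof (intro CollectI ballI)
    fix mon assume "mon \<in> Poly_Mapping.keys (f * g)"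
    then obtain a b where "mon = a + b" "a \<in> Poly_Mapping.keys f" "b \<in> Poly_Mapping.keys g"
      using keys_mult[of f g] by blast
    then show "Poly_Mapping.keys mon \<subseteq> V"
      using f g keys_add[of a b] by (fastforce simp: poly_ring_def)
  qed
qed

lemmas poly_ring_closed = is_subringD[OF is_subring_poly_ring]

lemma poly_ring_induct [consumes 1, case_names zero single add]:
  assumes f: "f \<in> poly_ring V"
    and zero: "P 0"
    and single: "\<And>mon c. Poly_Mapping.keys mon \<subseteq> V \<Longrightarrow> P (Poly_Mapping.single mon c)"
    and add: "\<And>f g. P f \<Longrightarrow> P g \<Longrightarrow> P (f + g)"
  shows "P f"
proof -
  have "P (\<Sum>mon \<in> M. Poly_Mapping.single mon (Poly_Mapping.lookup f mon))"
    if "M \<subseteq> Poly_Mapping.keys f" for M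
    using finite_subset[OF that finite_keys] that
    by (induction M) (use f in \<open>auto simp: poly_ring_def intro!: zero single add\<close>)
  moreover have "(\<Sum>mon \<in> Poly_Mapping.keys f. Poly_Mapping.single mon (Poly_Mapping.lookup f mon)) = f"
    by (intro poly_mapping_eqI) (auto simp: lookup_sum lookup_single when_def in_keys_iff)
  ultimately show ?thesis by (metis order_refl)
qed

lemma eval_at_single:
  "eval_at a (Poly_Mapping.single mon c) =
     c * (\<Prod>v \<in> Poly_Mapping.keys mon. a v ^ Poly_Mapping.lookup mon v)"
  by (simp add: eval_via_def)

lemma eval_at_add: "eval_at a (f + g) = eval_at a f + eval_at a g"
proof -
  define M where "M = Poly_Mapping.keys f \<union> Poly_Mapping.keys g"
  have M: "eval_at a h = (\<Sum>mon \<in> M. Poly_Mapping.lookup h mon *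
      (\<Prod>v \<in> Poly_Mapping.keys mon. a v ^ Poly_Mapping.lookup mon v))"
    if "Poly_Mapping.keys h \<subseteq> M" for h
    unfolding eval_via_def
    by (rule sum.mono_neutral_left) (use that in \<open>auto simp: M_def in_keys_iff\<close>)
  show ?thesis
    by (subst (1 2 3) M) (use keys_add[of f g] in
        \<open>auto simp: M_def lookup_add distrib_right sum.distrib\<close>)
qed

lemma eval_at_mult_single:
  "eval_at a (Poly_Mapping.single mon c * Poly_Mapping.single mon' c') =
     eval_at a (Poly_Mapping.single mon c) * eval_at a (Poly_Mapping.single mon' c')"
proof -
  define U where "U = Poly_Mapping.keys mon \<union> Poly_Mapping.keys mon'"
  have U: "(\<Prod>v \<in> Poly_Mapping.keys k. a v ^ Poly_Mapping.lookup k v) =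
      (\<Prod>v \<in> U. a v ^ Poly_Mapping.lookup k v)" if "Poly_Mapping.keys k \<subseteq> U" for k
    by (rule prod.mono_neutral_left) (use that in \<open>auto simp: U_def in_keys_iff\<close>)
  show ?thesis unfolding mult_single eval_at_single
    by (subst (1 2 3) U) (use keys_add[of mon mon'] in
        \<open>auto simp: U_def lookup_add power_add prod.distrib\<close>)
qed

lemma is_ring_hom_eval_at: "is_ring_hom (eval_at a)"
proof -
  have "eval_at a (f * g) = eval_at a f * eval_at a g" for f g
  proof -
    have "f \<in> poly_ring UNIV" by (simp add: poly_ring_UNIV)
    then show ?thesis
    proof (induction rule: poly_ring_induct)
      case (single mon c)
      have "g \<in> poly_ring UNIV" by (simp add: poly_ring_UNIV)
      then show ?case
      proof (induction rule: poly_ring_induct)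
        case zero
        show ?case by (simp add: eval_via_def)
      qed (auto simp: eval_at_mult_single eval_at_add distrib_left)
    qed (auto simp: eval_at_add distrib_right, auto simp: eval_via_def)
  qed
  moreover have "eval_at a 1 = 1" by (simp add: eval_via_def)
  ultimately show ?thesis by (auto simp: is_ring_hom_def eval_at_add)
qed

lemmas eval_at_simps = ring_homD[OF is_ring_hom_eval_at] ring_hom_sum[OF is_ring_hom_eval_at]
  ring_hom_prod[OF is_ring_hom_eval_at]

lemma eval_at_Var [simp]: "eval_at a (Var v) = a v"
  by (simp add: Var_def eval_at_single)

lemma Var_in_poly_ring: "v \<in> V \<Longrightarrow> Var v \<in> poly_ring V"
  unfolding Var_def by (rule single_in_poly_ring) auto

lemma eval_at_cong:
  assumes "f \<in> poly_ring V" "\<And>v. v \<in> V \<Longrightarrow> a v = b v"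
  shows "eval_at a f = eval_at b f"
  using assms(1)
proof (induction rule: poly_ring_induct)
  case (single mon c)
  then show ?case unfolding eval_at_single
    by (intro arg_cong[of _ _ "(*) c"] prod.cong) (auto simp: assms(2) subset_iff)
qed (auto simp: eval_at_simps)

lemma eval_at_restrict:
  "f \<in> poly_ring V \<Longrightarrow> V \<subseteq> W \<Longrightarrow> eval_at (restrict a W) f = eval_at a f"
  by (rule eval_at_cong) auto

definition Const :: "complex \<Rightarrow> mpoly" where
  "Const c = Poly_Mapping.single 0 c"

lemma eval_at_Const [simp]: "eval_at a (Const c) = c"
  by (simp add: Const_def eval_at_single)

lemma Const_in_poly_ring: "Const c \<in> poly_ring V"
  unfolding Const_def by (rule single_in_poly_ring) auto

lemma Var_power: "Var v ^ k = Poly_Mapping.single (Poly_Mapping.single v k) 1"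
  by (induction k) (auto simp: Var_def mult_single single_add [symmetric])

lemma split_off_variable:
  "Poly_Mapping.single mon c =
     Poly_Mapping.single (mon - Poly_Mapping.single v (Poly_Mapping.lookup mon v)) c *
       Var v ^ Poly_Mapping.lookup mon v"
  "Poly_Mapping.keys (mon - Poly_Mapping.single v (Poly_Mapping.lookup mon v)) =
     Poly_Mapping.keys mon - {v}"
proof -
  have "mon - Poly_Mapping.single v (Poly_Mapping.lookup mon v) +
      Poly_Mapping.single v (Poly_Mapping.lookup mon v) = mon"
    by (intro poly_mapping_eqI) (auto simp: lookup_add lookup_minus lookup_single when_def)
  then show "Poly_Mapping.single mon c =
     Poly_Mapping.single (mon - Poly_Mapping.single v (Poly_Mapping.lookup mon v)) c *
       Var v ^ Poly_Mapping.lookup mon v"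
    by (simp add: Var_power mult_single)
qed (auto simp: in_keys_iff lookup_minus lookup_single when_def split: if_splits)

text \<open>This reads C[V, v] as C[V][v] by collecting powers of \<open>v\<close>, monomial by
  monomial. Only the existence of \<open>G\<close> is claimed.\<close>

lemma poly_ring_insertE:
  assumes "f \<in> poly_ring (insert v V)"
  obtains G where "G \<in> polys_over (poly_ring V)" "poly G (Var v) = f"
proof -
  have "\<exists>G \<in> polys_over (poly_ring V). poly G (Var v) = f"
    using assms
  proof (induction rule: poly_ring_induct)
    case zero
    show ?case by (intro bexI[of _ 0]) (auto simp: polys_over_def poly_ring_closed)
  next
    case (single mon c)
    define mon' where "mon' = mon - Poly_Mapping.single v (Poly_Mapping.lookup mon v)"
    have "Poly_Mapping.single mon' c \<in> poly_ring V"
      using single split_off_variable(2)[of mon v]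
      by (intro single_in_poly_ring) (auto simp: mon'_def)
    then have "monom (Poly_Mapping.single mon' c) (Poly_Mapping.lookup mon v) \<in> polys_over (poly_ring V)"
      by (intro monom_in_polys_over is_subring_poly_ring)
    moreover have "poly (monom (Poly_Mapping.single mon' c) (Poly_Mapping.lookup mon v)) (Var v) =
        Poly_Mapping.single mon c"
      unfolding poly_monom mon'_def using split_off_variable(1)[of mon c v] by simp
    ultimately show ?case by blast
  next
    case (add f g)
    then show ?case
      using is_subringD(3)[OF is_subring_polys_over[OF is_subring_poly_ring]] by (metis poly_add)
  qed
  then show ?thesis using that by blast
qed

section \<open>Extension of points and Zariski closures\<close>

text \<open>Membership in I(A) without a fixed ambient ring: together with
  \<open>f \<in> poly_ring V\<close> it describes I(A) intersected with C[V], so that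
  \<open>V\<close> can grow while \<open>A\<close> stays the same.\<close>

definition vanishes_on :: "(pvar \<Rightarrow> complex) set \<Rightarrow> mpoly \<Rightarrow> bool" where
  "vanishes_on A f \<longleftrightarrow> (\<forall>w \<in> A. eval_at w f = 0)"

text \<open>The extension theorem applied to I(A) in C[V][v], with evaluation at \<open>a\<close> as
  specialization: the constants of this ideal form I(A) in C[V], which \<open>a\<close> kills by
  assumption.\<close>

lemma extend_to_variable:
  assumes v: "v \<notin> V"
    and a: "\<And>r. r \<in> poly_ring V \<Longrightarrow> vanishes_on A r \<Longrightarrow> eval_at a r = 0"
    and f: "f \<in> polys_over (poly_ring V)" "vanishes_on A (poly f (Var v))"
      "eval_at a (lead_coeff f) \<noteq> 0"
  shows "\<exists>b. \<forall>g \<in> poly_ring (insert v V). vanishes_on A g \<longrightarrow> eval_at (a(v := b)) g = 0"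
proof -
  define H where "H = {G \<in> polys_over (poly_ring V). vanishes_on A (poly G (Var v))}"
  note polys_over_closed = is_subringD[OF is_subring_polys_over[OF is_subring_poly_ring]]
  have "\<exists>b. \<forall>G \<in> H. poly (map_poly (eval_at a) G) b = 0"
  proof (rule extension_theorem)
    show "is_subring (poly_ring V)" by (rule is_subring_poly_ring)
    show "is_ring_hom (eval_at a)" by (rule is_ring_hom_eval_at)
    show "eval_at a ` poly_ring V = UNIV"
      using Const_in_poly_ring eval_at_Const by (metis UNIV_eq_I image_eqI)
    show "f + g \<in> H" if "f \<in> H" "g \<in> H" for f g
      using that by (auto simp: H_def vanishes_on_def eval_at_simps intro: polys_over_closed)
    show "f * g \<in> H" if "f \<in> polys_over (poly_ring V)" "g \<in> H" for f g
      using that by (auto simp: H_def vanishes_on_def eval_at_simps intro: polys_over_closed)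
    show "H \<subseteq> polys_over (poly_ring V)" by (auto simp: H_def)
    show "eval_at a r = 0" if "[:r:] \<in> H" for r
    proof (rule a)
      show "r \<in> poly_ring V"
        using that by (auto simp: H_def polys_over_def dest!: spec[of _ 0])
      show "vanishes_on A r" using that by (simp add: H_def)
    qed
    show "f \<in> H" "eval_at a (lead_coeff f) \<noteq> 0" using f by (auto simp: H_def)
  qed
  then obtain b where b: "\<And>G. G \<in> H \<Longrightarrow> poly (map_poly (eval_at a) G) b = 0" by blast
  have "eval_at (a(v := b)) g = 0" if "g \<in> poly_ring (insert v V)" "vanishes_on A g" for g
  proof -
    obtain G where G: "G \<in> polys_over (poly_ring V)" "poly G (Var v) = g"
      using poly_ring_insertE[OF \<open>g \<in> poly_ring (insert v V)\<close>] by blast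
    have "map_poly (eval_at (a(v := b))) G = map_poly (eval_at a) G"
    proof (rule poly_eqI)
      fix k
      have "coeff G k \<in> poly_ring V" using G by (auto simp: polys_over_def)
      then have "eval_at (a(v := b)) (coeff G k) = eval_at a (coeff G k)"
        by (rule eval_at_cong) (use v in auto)
      then show "coeff (map_poly (eval_at (a(v := b))) G) k = coeff (map_poly (eval_at a) G) k"
        by (simp add: coeff_map_poly eval_at_simps)
    qed
    then have "eval_at (a(v := b)) g = poly (map_poly (eval_at a) G) b"
      by (simp add: G(2) [symmetric] ring_hom_poly[OF is_ring_hom_eval_at])
    also have "\<dots> = 0" using G that by (intro b) (auto simp: H_def)
    finally show ?thesis .
  qed
  then show ?thesis by blast
qed

lemma restrict_in_affine_space: "restrict a V \<in> affine_space V"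
  by (simp add: affine_space_def restrict_PiE_iff)

lemma zariski_closure_eq:
  assumes "S \<subseteq> affine_space V"
  shows "zariski_closure V S = {a \<in> affine_space V. \<forall>f \<in> poly_ring V. vanishes_on S f \<longrightarrow> eval_at a f = 0}"
    (is "_ = ?C")
  unfolding zariski_closure_def
proof (rule hull_unique)
  show "S \<subseteq> ?C" using assms by (auto simp: vanishes_on_def)
  show "zariski_closed V ?C" unfolding zariski_closed_def
    by (intro exI[of _ "{f \<in> poly_ring V. vanishes_on S f}"]) auto
next
  fix T assume "S \<subseteq> T" "zariski_closed V T"
  then obtain P where "P \<subseteq> poly_ring V" "T = {a \<in> affine_space V. \<forall>f \<in> P. eval_at a f = 0}"
    by (auto simp: zariski_closed_def)
  with \<open>S \<subseteq> T\<close> show "?C \<subseteq> T" unfolding vanishes_on_def by blast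
qed

lemma vanishes_on_zariski_closure:
  assumes "S \<subseteq> affine_space V" "f \<in> poly_ring V"
  shows "vanishes_on (zariski_closure V S) f \<longleftrightarrow> vanishes_on S f"
  using assms by (auto simp: zariski_closure_eq vanishes_on_def)

section \<open>Algebraic dependence over \<open>\<complex>[t]\<close>\<close>

text \<open>A homogeneous system with more unknowns (\<open>S\<close>) than equations
  (\<open>B\<close>) has a nonzero solution. Fraction-free elimination proves this over a domain
  such as C[t].\<close>

lemma linear_dependence:
  fixes c :: "'s \<Rightarrow> 'b \<Rightarrow> 'a::idom"
  assumes "finite B" "finite S" "card B < card S"
  shows "\<exists>g. (\<exists>s \<in> S. g s \<noteq> 0) \<and> (\<forall>b \<in> B. (\<Sum>s \<in> S. g s * c s b) = 0)"
  using assms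
proof (induction B arbitrary: c S rule: finite_induct)
  case empty
  then have "S \<noteq> {}" by auto
  then show ?case by (intro exI[of _ "\<lambda>_. 1"]) auto
next
  case (insert b B)
  show ?case
  proof (cases "\<forall>s \<in> S. c s b = 0")
    case True
    have "card B < card S" using insert by simp
    then obtain g where "\<exists>s \<in> S. g s \<noteq> 0" "\<forall>b \<in> B. (\<Sum>s \<in> S. g s * c s b) = 0"
      using insert.IH[OF \<open>finite S\<close>] by blast
    then show ?thesis using True by auto
  next
    case False
    then obtain t where t: "t \<in> S" "c t b \<noteq> 0" by blast
    define S' where "S' = S - {t}"
    have S': "finite S'" "t \<notin> S'" "S = insert t S'" using insert t by (auto simp: S'_def)
    then have "card B < card S'" using insert by simp
    \<comment> \<open>The new coefficients are the 2 by 2 minors left after the unknown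
      \<open>t\<close> is eliminated with equation \<open>b\<close> as pivot.\<close>
    then obtain g where g: "\<exists>s \<in> S'. g s \<noteq> 0"
      "\<And>b'. b' \<in> B \<Longrightarrow> (\<Sum>s \<in> S'. g s * (c t b * c s b' - c s b * c t b')) = 0"
      using insert.IH[OF S'(1), of "\<lambda>s b'. c t b * c s b' - c s b * c t b'"] by blast
    \<comment> \<open>Equation \<open>b\<close> determines the unknown \<open>t\<close> up to
      division by the pivot \<open>c t b\<close>; scaling the other unknowns by the pivot avoids the
      division and, in a domain, keeps the solution nonzero.\<close>
    define h where "h s = (if s = t then - (\<Sum>s \<in> S'. g s * c s b) else c t b * g s)" for s
    have "(\<Sum>s \<in> S. h s * c s b') = (\<Sum>s \<in> S'. g s * (c t b * c s b' - c s b * c t b'))" for b'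
    proof -
      have "h t = - (\<Sum>s \<in> S'. g s * c s b)" by (simp add: h_def)
      moreover have "(\<Sum>s \<in> S'. h s * c s b') = (\<Sum>s \<in> S'. c t b * g s * c s b')"
        using S' by (intro sum.cong) (auto simp: h_def)
      ultimately show ?thesis
        using S'
        by (simp add: sum_distrib_left sum_distrib_right right_diff_distrib sum_subtractf mult_ac)
    qed
    then have "(\<Sum>s \<in> S. h s * c s b') = 0" if "b' \<in> insert b B" for b'
      using g(2) that by auto
    moreover have "\<exists>s \<in> S. h s \<noteq> 0" using g(1) S' t by (auto simp: h_def)
    ultimately show ?thesis by blast
  qed
qed

text \<open>Membership in the C[t]-module generated by \<open>B\<close>, with functions compared on
  \<open>Z\<close> only. This replaces the coordinate ring of \<open>Z\<close>, and no quotient ring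
  has to be formed.\<close>

definition spanned_on ::
  "(pvar \<Rightarrow> complex) set \<Rightarrow> ((pvar \<Rightarrow> complex) \<Rightarrow> complex) set \<Rightarrow> ((pvar \<Rightarrow> complex) \<Rightarrow> complex) \<Rightarrow> bool"
where
  "spanned_on Z B \<phi> \<longleftrightarrow> (\<exists>c. \<forall>w \<in> Z. \<phi> w = (\<Sum>b \<in> B. poly (c b) (w TV) * b w))"

lemma spanned_on_zero: "spanned_on Z B (\<lambda>_. 0)"
  unfolding spanned_on_def by (intro exI[of _ "\<lambda>_. 0"]) auto

lemma spanned_on_add:
  assumes "spanned_on Z B \<phi>" "spanned_on Z B \<psi>"
  shows "spanned_on Z B (\<lambda>w. \<phi> w + \<psi> w)"
proof -
  obtain c d where "\<forall>w \<in> Z. \<phi> w = (\<Sum>b \<in> B. poly (c b) (w TV) * b w)"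
    "\<forall>w \<in> Z. \<psi> w = (\<Sum>b \<in> B. poly (d b) (w TV) * b w)"
    using assms by (auto simp: spanned_on_def)
  then show ?thesis unfolding spanned_on_def
    by (intro exI[of _ "\<lambda>b. c b + d b"]) (auto simp: distrib_right sum.distrib)
qed

lemma spanned_on_sum:
  assumes "\<And>i. i \<in> I \<Longrightarrow> spanned_on Z B (\<phi> i)"
  shows "spanned_on Z B (\<lambda>w. \<Sum>i \<in> I. \<phi> i w)"
  using assms
  by (induction I rule: infinite_finite_induct) (auto intro: spanned_on_zero spanned_on_add)

lemma spanned_on_generator:
  assumes "finite B" "b \<in> B"
  shows "spanned_on Z B (\<lambda>w. poly f (w TV) * b w)"
  unfolding spanned_on_def
proof (intro exI[of _ "\<lambda>b'. if b' = b then f else 0"] ballI)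
  fix w
  have "(\<Sum>b' \<in> B. poly (if b' = b then f else 0) (w TV) * b' w) =
      (\<Sum>b' \<in> B. if b' = b then poly f (w TV) * b w else 0)"
    by (intro sum.cong) auto
  then show "poly f (w TV) * b w = (\<Sum>b' \<in> B. poly (if b' = b then f else 0) (w TV) * b' w)"
    using assms by simp
qed

lemma spanned_on_cong:
  "spanned_on Z B \<phi> \<Longrightarrow> (\<And>w. w \<in> Z \<Longrightarrow> \<psi> w = \<phi> w) \<Longrightarrow> spanned_on Z B \<psi>"
  by (auto simp: spanned_on_def)

text \<open>The triangular shape behind both uses of E: each polynomial is monic in its own
  variable, and the remainder involves only t and earlier variables.\<close>

definition radical_system :: "nat \<Rightarrow> (nat \<Rightarrow> nat) \<Rightarrow> (nat \<Rightarrow> mpoly) \<Rightarrow> (nat \<Rightarrow> mpoly) \<Rightarrow> bool" where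
  "radical_system m e g E \<longleftrightarrow>
     (\<forall>i \<in> {1..m}. e i > 0 \<and> g i \<in> poly_ring (td_vars (i - 1)) \<and> E i = Var (DV i) ^ e i - g i)"

lemma td_vars_0: "td_vars 0 = {TV}"
  by (simp add: td_vars_def)

lemma td_vars_Suc: "td_vars (Suc k) = insert (DV (Suc k)) (td_vars k)"
  by (auto simp: td_vars_def atLeastAtMostSuc_conv)

lemma td_vars_mono: "k \<le> m \<Longrightarrow> td_vars k \<subseteq> td_vars m"
  by (auto simp: td_vars_def)

text \<open>Each monic equation makes its variable integral over the previous ring, so finiteness
  over C[t] climbs the tower: the old generators are multiplied by the powers of the new variable
  below \<open>d\<close>.\<close>

lemma finitely_spanned_on_radical_system:
  assumes sys: "radical_system m e g E"
    and Z: "\<And>i w. i \<in> {1..m} \<Longrightarrow> w \<in> Z \<Longrightarrow> eval_at w (E i) = 0"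
    and "k \<le> m"
  shows "\<exists>B. finite B \<and> (\<forall>f \<in> poly_ring (td_vars k). spanned_on Z B (\<lambda>w. eval_at w f))"
  using \<open>k \<le> m\<close>
proof (induction k)
  case 0
  have "spanned_on Z {\<lambda>_. 1} (\<lambda>w. eval_at w f)" if "f \<in> poly_ring (td_vars 0)" for f
    using that unfolding td_vars_0
  proof (induction rule: poly_ring_induct)
    case zero
    show ?case by (simp add: eval_at_simps spanned_on_zero)
  next
    case (single mon c)
    define l where "l = Poly_Mapping.lookup mon TV"
    have "eval_at w (Poly_Mapping.single mon c) = poly (monom c l) (w TV) * 1" for w
    proof -
      have "(\<Prod>v \<in> Poly_Mapping.keys mon. w v ^ Poly_Mapping.lookup mon v) =
          (\<Prod>v \<in> {TV}. w v ^ Poly_Mapping.lookup mon v)"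
        by (rule prod.mono_neutral_left) (use single in \<open>auto simp: in_keys_iff\<close>)
      then show ?thesis by (simp add: eval_at_single poly_monom l_def)
    qed
    then show ?case using spanned_on_generator[of "{\<lambda>_. 1}" "\<lambda>_. 1"] by simp
  next
    case (add f g)
    then show ?case by (simp add: eval_at_simps spanned_on_add)
  qed
  then show ?case by (intro exI[of _ "{\<lambda>_. 1}"]) auto
next
  case (Suc k)
  then obtain B where B: "finite B" "\<And>f. f \<in> poly_ring (td_vars k) \<Longrightarrow> spanned_on Z B (\<lambda>w. eval_at w f)"
    by auto
  define v where "v = DV (Suc k)"
  define d where "d = e (Suc k)"
  have d: "d > 0" and g: "g (Suc k) \<in> poly_ring (td_vars k)" and
    E: "E (Suc k) = Var v ^ d - g (Suc k)"
    using sys [unfolded radical_system_def, THEN bspec, of "Suc k"] Suc.prems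
    by (auto simp: v_def d_def)
  define B' where "B' = (\<lambda>(b, l) w. b w * w v ^ l) ` (B \<times> {..<d})"
  have "finite B'" using B by (auto simp: B'_def)
  have "spanned_on Z B' (\<lambda>w. eval_at w f)" if "f \<in> poly_ring (td_vars (Suc k))" for f
    using that unfolding td_vars_Suc v_def [symmetric]
  proof (induction rule: poly_ring_induct)
    case zero
    show ?case by (simp add: eval_at_simps spanned_on_zero)
  next
    case (single mon c)
    define l where "l = Poly_Mapping.lookup mon v"
    define mon' where "mon' = mon - Poly_Mapping.single v l"
    \<comment> \<open>On \<open>Z\<close> the power \<open>w v ^ d\<close> equals the value of
      \<open>g (Suc k)\<close>. Writing \<open>l\<close> as \<open>d * (l div d) + l mod d\<close>
      turns all but a power below \<open>d\<close> into a polynomial in the earlier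
      variables.\<close>
    define f where "f = Poly_Mapping.single mon' c * g (Suc k) ^ (l div d)"
    have "Poly_Mapping.keys mon' \<subseteq> td_vars k"
      using single split_off_variable(2)[of mon v] by (auto simp: mon'_def l_def)
    then have "f \<in> poly_ring (td_vars k)"
      unfolding f_def by (intro poly_ring_closed g single_in_poly_ring)
    then obtain h where h: "\<And>w. w \<in> Z \<Longrightarrow> eval_at w f = (\<Sum>b \<in> B. poly (h b) (w TV) * b w)"
      using B(2) unfolding spanned_on_def by blast
    have eq: "eval_at w (Poly_Mapping.single mon c) =
        (\<Sum>b \<in> B. poly (h b) (w TV) * (b w * w v ^ (l mod d)))" if "w \<in> Z" for w
    proof -
      have "eval_at w (E (Suc k)) = 0" using Z[OF _ that] Suc.prems by auto
      then have "w v ^ d = eval_at w (g (Suc k))" by (simp add: E eval_at_simps)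
      moreover have "w v ^ l = (w v ^ d) ^ (l div d) * w v ^ (l mod d)"
        by (simp flip: power_mult power_add)
      ultimately have "eval_at w (Poly_Mapping.single mon c) = eval_at w f * w v ^ (l mod d)"
        by (simp add: split_off_variable(1)[of mon c v] eval_at_simps f_def mon'_def l_def)
      then show ?thesis by (simp add: h[OF that] sum_distrib_right mult.assoc)
    qed
    have "spanned_on Z B' (\<lambda>w. \<Sum>b \<in> B. poly (h b) (w TV) * (b w * w v ^ (l mod d)))"
    proof (rule spanned_on_sum)
      fix b assume "b \<in> B"
      then have "(\<lambda>w. b w * w v ^ (l mod d)) \<in> B'"
        using d unfolding B'_def by (intro image_eqI[of _ _ "(b, l mod d)"]) auto
      then show "spanned_on Z B' (\<lambda>w. poly (h b) (w TV) * (b w * w v ^ (l mod d)))"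
        by (rule spanned_on_generator[OF \<open>finite B'\<close>])
    qed
    then show ?case by (rule spanned_on_cong) (rule eq)
  next
    case (add f g)
    then show ?case by (simp add: eval_at_simps spanned_on_add)
  qed
  with \<open>finite B'\<close> show ?case by blast
qed

text \<open>
  More than \<open>card B\<close> of the products \<open>p\<^sup>j q\<^sup>r\<^sup>-\<^sup>j\<close> are linearly dependent over \<open>\<complex>[t]\<close>; dividing a
  relation by \<open>q\<^sup>r\<close> gives an equation for \<open>p / q\<close>, even if \<open>q\<close> vanishes on part of the variety.
\<close>
lemma quotient_algebraic_over_t:
  assumes sys: "radical_system m e g E"
    and pq: "p \<in> poly_ring (td_vars m)" "q \<in> poly_ring (td_vars m)"
  obtains G :: "complex poly poly" where "G \<noteq> 0"
    "\<And>w x. (\<And>i. i \<in> {1..m} \<Longrightarrow> eval_at w (E i) = 0) \<Longrightarrow> eval_at w q \<noteq> 0 \<Longrightarrow>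
       eval_at w p = x * eval_at w q \<Longrightarrow> poly (poly G [:w TV:]) x = 0"
proof -
  define Z where "Z = {w. \<forall>i \<in> {1..m}. eval_at w (E i) = 0}"
  obtain B where B: "finite B" "\<And>f. f \<in> poly_ring (td_vars m) \<Longrightarrow> spanned_on Z B (\<lambda>w. eval_at w f)"
    using finitely_spanned_on_radical_system[OF sys, of Z m] by (auto simp: Z_def)
  define r where "r = card B"
  have ex: "\<forall>j. \<exists>c. \<forall>w \<in> Z. eval_at w (p ^ j * q ^ (r - j)) = (\<Sum>b \<in> B. poly (c b) (w TV) * b w)"
    using pq unfolding spanned_on_def [symmetric] by (intro allI B(2) poly_ring_closed)
  obtain c where c: "\<And>j w. w \<in> Z \<Longrightarrow>
      eval_at w (p ^ j * q ^ (r - j)) = (\<Sum>b \<in> B. poly (c j b) (w TV) * b w)"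
    using choice[OF ex] by blast
  \<comment> \<open>The index range 0 to \<open>r\<close> has \<open>card B + 1\<close> elements,
    just enough to force a dependence.\<close>
  obtain h where h: "\<exists>j \<in> {..r}. h j \<noteq> 0" "\<And>b. b \<in> B \<Longrightarrow> (\<Sum>j \<le> r. h j * c j b) = 0"
    using linear_dependence[of B "{..r}" c] B(1) by (auto simp: r_def)
  \<comment> \<open>The variable of \<open>h j\<close> is t, which is the outer variable of
    \<open>G\<close>; so its coefficients become constants in x, and the exponent \<open>j\<close>
    goes to the inner variable.\<close>
  define G where "G = (\<Sum>j \<le> r. smult (monom 1 j) (map_poly (\<lambda>c. [:c:]) (h j)))"
  have G_coeff: "coeff (coeff G k) j = coeff (h j) k" if "j \<le> r" for j k
    using that by (simp add: G_def coeff_sum coeff_map_poly coeff_monom_mult mult.commute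
        coeff_pCons if_distrib[of "\<lambda>x. _ * x"] split: nat.splits cong: if_cong)
  have const_hom: "is_ring_hom (\<lambda>c::complex. [:c:])" by (auto simp: is_ring_hom_def)
  have G_eval: "poly (poly G [:t:]) x = (\<Sum>j \<le> r. x ^ j * poly (h j) t)" for t x
    by (simp add: G_def poly_sum poly_monom ring_hom_poly[OF const_hom, symmetric] mult.commute)
  show ?thesis
  proof (rule that)
    show "G \<noteq> 0"
    proof
      assume "G = 0"
      then have "h j = 0" if "j \<le> r" for j using G_coeff[OF that] by (auto intro: poly_eqI)
      then show False using h(1) by auto
    qed
  next
    fix w x
    assume w: "\<And>i. i \<in> {1..m} \<Longrightarrow> eval_at w (E i) = 0"
      and q: "eval_at w q \<noteq> 0" and p: "eval_at w p = x * eval_at w q"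
    have "w \<in> Z" using w by (auto simp: Z_def)
    have pow: "x ^ j * eval_at w q ^ r = eval_at w (p ^ j * q ^ (r - j))" if "j \<le> r" for j
      using that by (simp add: eval_at_simps p power_mult_distrib flip: power_add)
    have "poly (poly G [:w TV:]) x * eval_at w q ^ r =
        (\<Sum>j \<le> r. poly (h j) (w TV) * (x ^ j * eval_at w q ^ r))"
      by (simp add: G_eval sum_distrib_left mult_ac)
    also have "\<dots> = (\<Sum>j \<le> r. \<Sum>b \<in> B. poly (h j * c j b) (w TV) * b w)"
      by (intro sum.cong refl) (simp add: pow c[OF \<open>w \<in> Z\<close>] sum_distrib_left mult_ac)
    also have "\<dots> = (\<Sum>b \<in> B. poly (\<Sum>j \<le> r. h j * c j b) (w TV) * b w)"
      by (subst sum.swap) (simp add: poly_sum sum_distrib_right)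
    also have "\<dots> = 0" by (intro sum.neutral) (simp add: h(2))
    finally show "poly (poly G [:w TV:]) x = 0" using q by simp
  qed
qed


section \<open>Lifting points of the curve\<close>

lemma xt_monomial:
  "Poly_Mapping.single (Poly_Mapping.single TV k + Poly_Mapping.single (XV i) l) c =
     Const c * (Var TV ^ k * Var (XV i) ^ l)"
  by (simp add: Const_def Var_power mult_single)

lemma xt_poly_in_poly_ring:
  assumes "TV \<in> V" "XV i \<in> V"
  shows "xt_poly i G \<in> poly_ring V"
  unfolding xt_poly_def xt_monomial
  by (intro subring_sum is_subring_poly_ring poly_ring_closed Const_in_poly_ring Var_in_poly_ring assms)

lemma eval_at_xt_poly: "eval_at w (xt_poly i G) = poly (poly G [:w TV:]) (w (XV i))"
  by (simp add: xt_poly_def xt_monomial eval_at_simps poly_altdef[of G] poly_sum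
      poly_altdef[of "coeff G _"] sum_distrib_left sum_distrib_right mult_ac)

text \<open>Only x_i is replaced by its \<open>mpoly\<close> variable, while t stays the polynomial
  variable: the shape that \<open>extend_to_variable\<close> expects of \<open>f\<close>.\<close>

definition xt_lift :: "nat \<Rightarrow> complex poly poly \<Rightarrow> mpoly poly" where
  "xt_lift i G = map_poly (\<lambda>c. poly (map_poly Const c) (Var (XV i))) G"

lemma is_ring_hom_Const: "is_ring_hom Const"
  by (auto simp: is_ring_hom_def Const_def single_add mult_single)

lemma xt_lift_coeff: "coeff (xt_lift i G) k = poly (map_poly Const (coeff G k)) (Var (XV i))"
  by (simp add: xt_lift_def coeff_map_poly)

lemma eval_at_xt_lift_coeff: "eval_at w (coeff (xt_lift i G) k) = poly (coeff G k) (w (XV i))"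
proof -
  have "map_poly (eval_at w) (map_poly Const f) = f" for f
    by (intro poly_eqI) (simp add: coeff_map_poly eval_at_simps ring_homD[OF is_ring_hom_Const])
  then show ?thesis by (simp add: xt_lift_coeff ring_hom_poly[OF is_ring_hom_eval_at])
qed

lemma xt_lift_in_polys_over: "XV i \<in> V \<Longrightarrow> xt_lift i G \<in> polys_over (poly_ring V)"
  unfolding polys_over_def
  by (auto simp: xt_lift_coeff poly_altdef coeff_map_poly ring_homD[OF is_ring_hom_Const] intro!: subring_sum
      is_subring_poly_ring poly_ring_closed Const_in_poly_ring Var_in_poly_ring)

lemma degree_xt_lift_le: "degree (xt_lift i G) \<le> degree G"
  by (intro degree_le) (simp add: xt_lift_coeff coeff_eq_0)

lemma eval_at_poly_xt_lift: "eval_at w (poly (xt_lift i G) (Var TV)) = eval_at w (xt_poly i G)"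
proof -
  have hom: "is_ring_hom (\<lambda>f. poly f (w (XV i)))" by (auto simp: is_ring_hom_def)
  have "map_poly (eval_at w) (xt_lift i G) = map_poly (\<lambda>f. poly f (w (XV i))) G"
    by (intro poly_eqI) (simp add: coeff_map_poly eval_at_simps eval_at_xt_lift_coeff)
  then show ?thesis
    by (simp add: ring_hom_poly[OF is_ring_hom_eval_at] eval_at_xt_poly ring_hom_poly[OF hom])
qed

section \<open>Lifting along the triangular equations\<close>

lemma radical_curve_parametrization_system:
  assumes "radical_curve_parametrization \<iota> m \<delta> E n p q"
  obtains e g where "radical_system m e g E"
proof -
  obtain e where "radical_tower \<iota> m e \<delta>" "defining_polys \<iota> m e \<delta> E"
    using assms unfolding radical_curve_parametrization_def by blast
  then have ex: "\<forall>i \<in> {1..m}. \<exists>g. e i > 0 \<and> g \<in> poly_ring (td_vars (i - 1)) \<and> E i = Var (DV i) ^ e i - g"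
    unfolding radical_tower_def defining_polys_def by blast
  obtain g where "radical_system m e g E"
    using bchoice[OF ex] unfolding radical_system_def by blast
  then show ?thesis by (rule that)
qed

lemma radical_system_in_poly_ring:
  assumes "radical_system m e g E" "i \<in> {1..m}"
  shows "E i \<in> poly_ring (td_vars m)"
proof -
  have "E i = Var (DV i) ^ e i + - g i" "g i \<in> poly_ring (td_vars (i - 1))"
    using assms by (auto simp: radical_system_def)
  moreover have "poly_ring (td_vars (i - 1)) \<subseteq> poly_ring (td_vars m)"
    using assms(2) by (intro poly_ring_mono td_vars_mono) auto
  moreover have "DV i \<in> td_vars m" using assms(2) by (auto simp: td_vars_def)
  ultimately show ?thesis by (metis poly_ring_closed(3,5,6) Var_in_poly_ring subsetD)
qed

text \<open>The leading coefficient 1 of each equation vanishes nowhere, so no point is exceptional.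
  The induction carries all of I(A) in the current variables, since zeros of E alone need not lie in
  A.\<close>

lemma extend_along_radical_system:
  assumes sys: "radical_system m e g E"
    and E: "\<And>i. i \<in> {1..m} \<Longrightarrow> vanishes_on A (E i)"
    and a: "\<And>r. r \<in> poly_ring (td_vars 0 \<union> x_vars n) \<Longrightarrow> vanishes_on A r \<Longrightarrow> eval_at a r = 0"
    and "k \<le> m"
  shows "\<exists>b. (\<forall>v \<in> x_vars n. b v = a v) \<and>
    (\<forall>r \<in> poly_ring (td_vars k \<union> x_vars n). vanishes_on A r \<longrightarrow> eval_at b r = 0)"
  using \<open>k \<le> m\<close>
proof (induction k)
  case 0
  then show ?case using a by blast
next
  case (Suc k)
  then obtain b where b: "\<forall>v \<in> x_vars n. b v = a v"
    "\<And>r. r \<in> poly_ring (td_vars k \<union> x_vars n) \<Longrightarrow> vanishes_on A r \<Longrightarrow> eval_at b r = 0"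
    by auto
  define V where "V = td_vars k \<union> x_vars n"
  define d where "d = e (Suc k)"
  have d: "d > 0" and g: "g (Suc k) \<in> poly_ring (td_vars k)" and
    Ek: "E (Suc k) = Var (DV (Suc k)) ^ d - g (Suc k)"
    using sys [unfolded radical_system_def, THEN bspec, of "Suc k"] Suc.prems
    by (auto simp: d_def)
  have gV: "g (Suc k) \<in> poly_ring V" using g poly_ring_mono[of "td_vars k" V] by (auto simp: V_def)
  define f where "f = monom 1 d + [:- g (Suc k):]"
  have "DV (Suc k) \<notin> V" by (auto simp: V_def td_vars_def x_vars_def)
  moreover have "eval_at b r = 0" if "r \<in> poly_ring V" "vanishes_on A r" for r
    using b(2) that by (auto simp: V_def)
  moreover have "f \<in> polys_over (poly_ring V)" unfolding f_def
    by (intro is_subringD(3)[OF is_subring_polys_over] monom_in_polys_over const_in_polys_over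
        is_subring_poly_ring poly_ring_closed gV)
  moreover have "poly f (Var (DV (Suc k))) = E (Suc k)" by (simp add: f_def poly_monom Ek)
  then have "vanishes_on A (poly f (Var (DV (Suc k))))" using E[of "Suc k"] Suc.prems by simp
  moreover have "degree f = d" using d unfolding f_def
    by (subst degree_add_eq_left) (auto simp: degree_monom_eq)
  then have "lead_coeff f = 1" using d by (simp add: f_def coeff_pCons split: nat.splits)
  then have "eval_at b (lead_coeff f) \<noteq> 0" by (simp add: eval_at_simps)
  ultimately obtain c where c: "\<forall>r \<in> poly_ring (insert (DV (Suc k)) V).
      vanishes_on A r \<longrightarrow> eval_at (b(DV (Suc k) := c)) r = 0"
    using extend_to_variable by metis
  moreover have "\<forall>v \<in> x_vars n. (b(DV (Suc k) := c)) v = a v" using b(1) by (auto simp: x_vars_def)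
  moreover have "td_vars (Suc k) \<union> x_vars n = insert (DV (Suc k)) V" by (simp add: V_def td_vars_Suc)
  ultimately show ?case by metis
qed

section \<open>Vanishing on D, A and X\<close>

lemma D_setD:
  assumes lcm: "is_lcm (td_vars m) L (q ` {1..n})" and a: "a \<in> D_set m E n p q L"
  shows "i \<in> {1..m} \<Longrightarrow> eval_at a (E i) = 0"
    "i \<in> {1..n} \<Longrightarrow> eval_at a (p i) = a (XV i) * eval_at a (q i)"
    "i \<in> {1..n} \<Longrightarrow> eval_at a (q i) \<noteq> 0"
proof -
  assume i: "i \<in> {1..n}"
  \<comment> \<open>The equation z L = 1 makes L nonzero at \<open>a\<close>, hence also each of its
    divisors.\<close>
  then have "q i dvd L" using lcm by (auto simp: is_lcm_def)
  then obtain K where "L = q i * K" ..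
  then show "eval_at a (q i) \<noteq> 0" using a by (auto simp: D_set_def eval_at_simps)
qed (use a in \<open>auto simp: D_set_def\<close>)

text \<open>Taking the closure imposes nothing new on polynomials, and the projection forgets only
  z, which \<open>f\<close> does not contain. Questions about I(A) thus reduce to the explicit
  equations of D.\<close>

lemma vanishes_on_A_set:
  assumes "f \<in> poly_ring (td_vars m \<union> x_vars n)"
  shows "vanishes_on (A_set m E n p q L) f \<longleftrightarrow> (\<forall>a \<in> D_set m E n p q L. eval_at a f = 0)"
proof -
  have "(\<lambda>a. restrict a (td_vars m \<union> x_vars n)) ` D_set m E n p q L \<subseteq> affine_space (td_vars m \<union> x_vars n)"
    by (simp add: image_subset_iff restrict_in_affine_space)
  then show ?thesis using assms
    by (simp add: A_set_def vanishes_on_zariski_closure)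
      (simp add: vanishes_on_def eval_at_restrict)
qed

lemma in_A_setI:
  assumes "\<And>r. r \<in> poly_ring (td_vars m \<union> x_vars n) \<Longrightarrow> vanishes_on (A_set m E n p q L) r \<Longrightarrow> eval_at a r = 0"
  shows "restrict a (td_vars m \<union> x_vars n) \<in> A_set m E n p q L"
proof -
  let ?W = "td_vars m \<union> x_vars n"
  let ?D = "(\<lambda>a. restrict a ?W) ` D_set m E n p q L"
  have D: "?D \<subseteq> affine_space ?W" by (simp add: image_subset_iff restrict_in_affine_space)
  have "eval_at (restrict a ?W) r = 0" if "r \<in> poly_ring ?W" "vanishes_on ?D r" for r
    using assms[of r] that vanishes_on_zariski_closure[OF D, of r]
    by (simp add: eval_at_restrict A_set_def)
  then show ?thesis
    unfolding A_set_def zariski_closure_eq[OF D] by (simp add: restrict_in_affine_space)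
qed

text \<open>Every point of X is the x-part of a point of D: its parameters \<open>a\<close> are
  completed by z = 1 / L(a).\<close>

lemma X_set_vanishing:
  assumes lcm: "is_lcm (td_vars m) L (q ` {1..n})"
    and pq: "\<And>i. i \<in> {1..n} \<Longrightarrow> p i \<in> poly_ring (td_vars m) \<and> q i \<in> poly_ring (td_vars m)"
    and E: "\<And>i. i \<in> {1..m} \<Longrightarrow> E i \<in> poly_ring (td_vars m)"
    and f: "f \<in> poly_ring (x_vars n)" "vanishes_on (A_set m E n p q L) f"
  shows "vanishes_on (X_set m E n p q) f"
  unfolding vanishes_on_def
proof
  fix x assume "x \<in> X_set m E n p q"
  then obtain a where a: "\<And>i. i \<in> {1..m} \<Longrightarrow> eval_at a (E i) = 0"
    "\<And>i. i \<in> {1..n} \<Longrightarrow> eval_at a (q i) \<noteq> 0"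
    "\<And>i. i \<in> {1..n} \<Longrightarrow> eval_at a (p i) / eval_at a (q i) = x (XV i)"
    unfolding X_set_def by blast
  \<comment> \<open>Minimality of the least common multiple is used here: a zero of L would be a
    zero of some \<open>q i\<close>.\<close>
  have "L dvd (\<Prod>i \<in> {1..n}. q i)"
    using lcm unfolding is_lcm_def
    by (auto intro!: dvd_prodI subring_prod is_subring_poly_ring simp: pq)
  then obtain K where "(\<Prod>i \<in> {1..n}. q i) = L * K" ..
  then have "(\<Prod>i \<in> {1..n}. eval_at a (q i)) = eval_at a L * eval_at a K"
    by (simp flip: eval_at_simps)
  then have L: "eval_at a L \<noteq> 0" using a(2) by (metis finite_atLeastAtMost mult_zero_left prod_zero_iff)
  let ?W = "td_vars m \<union> x_vars n \<union> {ZV}"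
  define w where "w = restrict (\<lambda>v. if v \<in> td_vars m then a v else if v = ZV then 1 / eval_at a L else x v) ?W"
  have "w \<in> affine_space ?W" unfolding w_def by (rule restrict_in_affine_space)
  have w: "eval_at w r = eval_at a r" if "r \<in> poly_ring (td_vars m)" for r
    using that by (rule eval_at_cong) (auto simp: w_def)
  have [simp]: "w ZV = 1 / eval_at a L" by (auto simp: w_def td_vars_def)
  have wx: "w v = x v" if "v \<in> x_vars n" for v using that by (auto simp: w_def td_vars_def x_vars_def)
  have "L \<in> poly_ring (td_vars m)" using lcm by (auto simp: is_lcm_def)
  then have "w \<in> D_set m E n p q L"
    unfolding D_set_def using a L pq E \<open>w \<in> affine_space ?W\<close>
    by (auto simp: w wx x_vars_def field_simps)
  moreover have "f \<in> poly_ring (td_vars m \<union> x_vars n)"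
    using f poly_ring_mono[of "x_vars n" "td_vars m \<union> x_vars n"] by auto
  ultimately have "eval_at w f = 0" using f(2) vanishes_on_A_set by blast
  then show "eval_at x f = 0" using eval_at_cong[OF f(1), of w x] wx by simp
qed

lemma liftable_if_lead_coeff_nonzero:
  assumes param: "radical_curve_parametrization \<iota> m \<delta> E n p q"
    and lcm: "is_lcm (td_vars m) L (q ` {1..n})"
    and i: "i \<in> {1..n}"
    and F: "F \<in> elim_ideal i (vanishing_ideal (td_vars m \<union> x_vars n) (A_set m E n p q L))"
    and x: "x \<in> zariski_closure (x_vars n) (X_set m E n p q)"
    and nz: "poly (lead_coeff F) (x (XV i)) \<noteq> 0"
  shows "liftable n (A_set m E n p q L) x"
proof -
  define A where "A = A_set m E n p q L"
  obtain e g where sys: "radical_system m e g E" using radical_curve_parametrization_system[OF param] .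
  have E: "E i \<in> poly_ring (td_vars m)" if "i \<in> {1..m}" for i
    using radical_system_in_poly_ring[OF sys that] .
  have EA: "vanishes_on A (E i)" if "i \<in> {1..m}" for i
  proof -
    have "E i \<in> poly_ring (td_vars m \<union> x_vars n)"
      using E[OF that] poly_ring_mono[of "td_vars m" "td_vars m \<union> x_vars n"] by auto
    then show ?thesis unfolding A_def using D_setD(1)[OF lcm _ that] by (simp add: vanishes_on_A_set)
  qed
  have pq: "p i \<in> poly_ring (td_vars m) \<and> q i \<in> poly_ring (td_vars m)" if "i \<in> {1..n}" for i
    using param that by (auto simp: radical_curve_parametrization_def)
  have X: "X_set m E n p q \<subseteq> affine_space (x_vars n)" by (auto simp: X_set_def)
  have x_A: "eval_at x r = 0" if "r \<in> poly_ring (x_vars n)" "vanishes_on A r" for r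
    using x that X_set_vanishing[OF lcm pq E] by (auto simp: zariski_closure_eq[OF X] A_def)
  have "\<exists>b. \<forall>r \<in> poly_ring (insert TV (x_vars n)). vanishes_on A r \<longrightarrow> eval_at (x(TV := b)) r = 0"
  proof (rule extend_to_variable[OF _ x_A])
    show "TV \<notin> x_vars n" by (auto simp: x_vars_def)
    show "xt_lift i F \<in> polys_over (poly_ring (x_vars n))"
      using i by (intro xt_lift_in_polys_over) (auto simp: x_vars_def)
    show "vanishes_on A (poly (xt_lift i F) (Var TV))"
      using F by (auto simp: vanishes_on_def eval_at_poly_xt_lift elim_ideal_def vanishing_ideal_def A_def)
    have lc: "eval_at x (coeff (xt_lift i F) (degree F)) \<noteq> 0"
      using nz by (simp add: eval_at_xt_lift_coeff)
    \<comment> \<open>The substitution for x_i could a priori lower the degree; the coefficient in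
      degree \<open>degree F\<close> survives because its value at \<open>x\<close> is
      nonzero.\<close>
    then have "degree (xt_lift i F) = degree F"
      using degree_xt_lift_le[of i F] le_degree[of "xt_lift i F" "degree F"]
      by (cases "coeff (xt_lift i F) (degree F) = 0") (auto simp: eval_at_simps)
    then show "eval_at x (lead_coeff (xt_lift i F)) \<noteq> 0" using lc by simp
  qed
  then obtain b where b: "\<And>r. r \<in> poly_ring (td_vars 0 \<union> x_vars n) \<Longrightarrow> vanishes_on A r \<Longrightarrow>
      eval_at (x(TV := b)) r = 0"
    by (auto simp: td_vars_0)
  obtain a where a: "\<And>v. v \<in> x_vars n \<Longrightarrow> a v = (x(TV := b)) v"
    "\<And>r. r \<in> poly_ring (td_vars m \<union> x_vars n) \<Longrightarrow> vanishes_on A r \<Longrightarrow> eval_at a r = 0"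
    using extend_along_radical_system[OF sys EA b order_refl] by blast
  have "restrict a (td_vars m \<union> x_vars n) \<in> A"
    using a(2) unfolding A_def by (rule in_A_setI)
  \<comment> \<open>Points are total functions, so \<open>liftable\<close> demands equality off
    \<open>x_vars n\<close> as well, where \<open>restrict\<close> yields
    \<open>undefined\<close>.\<close>
  moreover have "x \<in> extensional (x_vars n)"
    using x by (auto simp: zariski_closure_eq[OF X] affine_space_def PiE_def)
  then have "restrict (restrict a (td_vars m \<union> x_vars n)) (x_vars n) = x"
    using a(1) by (intro extensionalityI[of _ "x_vars n"]) (auto simp: x_vars_def)
  ultimately show ?thesis unfolding liftable_def A_def by blast
qed

text \<open>The equation for p_i / q_i over C[t] holds on all of D, where q_i has no zero. It rules
  out a zero generator, whose leading coefficient would give no bound on the exceptional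
  points.\<close>

lemma elim_ideal_nonzero:
  assumes param: "radical_curve_parametrization \<iota> m \<delta> E n p q"
    and lcm: "is_lcm (td_vars m) L (q ` {1..n})"
    and i: "i \<in> {1..n}"
  obtains G where "G \<noteq> 0"
    "G \<in> elim_ideal i (vanishing_ideal (td_vars m \<union> x_vars n) (A_set m E n p q L))"
proof -
  obtain e g where sys: "radical_system m e g E" using radical_curve_parametrization_system[OF param] .
  have pq: "p i \<in> poly_ring (td_vars m)" "q i \<in> poly_ring (td_vars m)"
    using param i by (auto simp: radical_curve_parametrization_def)
  obtain G where G: "G \<noteq> 0"
    "\<And>w x. (\<And>i. i \<in> {1..m} \<Longrightarrow> eval_at w (E i) = 0) \<Longrightarrow> eval_at w (q i) \<noteq> 0 \<Longrightarrow>
       eval_at w (p i) = x * eval_at w (q i) \<Longrightarrow> poly (poly G [:w TV:]) x = 0"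
    using quotient_algebraic_over_t[OF sys pq] by blast
  have "eval_at w (xt_poly i G) = 0" if "w \<in> D_set m E n p q L" for w
    using G(2) D_setD[OF lcm that] i by (simp add: eval_at_xt_poly)
  moreover have "xt_poly i G \<in> poly_ring (td_vars m \<union> x_vars n)"
    using i by (intro xt_poly_in_poly_ring) (auto simp: td_vars_def x_vars_def)
  ultimately have "G \<in> elim_ideal i (vanishing_ideal (td_vars m \<union> x_vars n) (A_set m E n p q L))"
    using vanishes_on_A_set[of "xt_poly i G"]
    by (auto simp: elim_ideal_def vanishing_ideal_def vanishes_on_def)
  then show ?thesis using G(1) that by blast
qed

text \<open>Points are determined by their coordinates, so \<open>N\<close> embeds into the product
  of the root sets of the \<open>c i\<close>.\<close>

lemma card_common_roots_le:
  assumes c: "\<And>i. i \<in> {1..n} \<Longrightarrow> c i \<noteq> (0 :: complex poly)"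
    and N: "N \<subseteq> affine_space (x_vars n)" "\<And>x i. x \<in> N \<Longrightarrow> i \<in> {1..n} \<Longrightarrow> poly (c i) (x (XV i)) = 0"
  shows "finite N \<and> card N \<le> (\<Prod>i \<in> {1..n}. degree (c i))"
proof -
  define R where "R i = {z. poly (c i) z = 0}" for i
  let ?\<Phi> = "\<lambda>x. \<lambda>i \<in> {1..n}. x (XV i)"
  have R: "finite (R i) \<and> card (R i) \<le> degree (c i)" if "i \<in> {1..n}" for i
    using c[OF that] by (simp add: R_def poly_roots_finite card_poly_roots_bound)
  have fin: "finite (PiE {1..n} R)" using R by (intro finite_PiE) auto
  have sub: "?\<Phi> ` N \<subseteq> PiE {1..n} R" using N(2) by (auto simp: R_def)
  have inj: "inj_on ?\<Phi> N"
  proof (rule inj_onI)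
    fix x y assume x: "x \<in> N" and y: "y \<in> N" and eq: "?\<Phi> x = ?\<Phi> y"
    have "x (XV i) = y (XV i)" if "i \<in> {1..n}" for i
      using fun_cong[OF eq, of i] that by simp
    then show "x = y"
      using x y N(1) by (intro extensionalityI[of _ "x_vars n"]) (auto simp: affine_space_def PiE_def x_vars_def)
  qed
  have "card N = card (?\<Phi> ` N)" using inj by (simp add: card_image)
  also have "\<dots> \<le> card (PiE {1..n} R)" by (rule card_mono[OF fin sub])
  also have "\<dots> \<le> (\<Prod>i \<in> {1..n}. degree (c i))"
    using R by (simp add: card_PiE) (intro prod_mono, auto)
  finally show ?thesis using finite_imageD[OF finite_subset[OF sub fin] inj] by blast
qed

text \<open>Finiteness accompanies the bound because \<open>card\<close> is 0 on infinite sets. A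
  generator is unique up to a nonzero constant factor, which changes neither the roots nor the
  degree of its leading coefficient.\<close>

theorem mainTheorem4:
  fixes \<iota> :: "complex poly fract \<Rightarrow> 'k::field"
    and m n :: nat
    and \<delta> :: "nat \<Rightarrow> 'k"
    and E p q :: "nat \<Rightarrow> mpoly"
    and L :: mpoly
    and F :: "nat \<Rightarrow> complex poly poly"
  assumes param: "radical_curve_parametrization \<iota> m \<delta> E n p q"
    and lcm: "is_lcm (td_vars m) L (q ` {1..n})"
    and gen: "\<And>i. i \<in> {1..n} \<Longrightarrow>
      elim_ideal i (vanishing_ideal (td_vars m \<union> x_vars n) (A_set m E n p q L)) =
        {F i * H | H. True}"
  shows "(\<forall>x \<in> zariski_closure (x_vars n) (X_set m E n p q).
            \<not> liftable n (A_set m E n p q L) x \<longrightarrow>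
              (\<forall>i \<in> {1..n}. poly (lead_coeff (F i)) (x (XV i)) = 0)) \<and>
         finite {x \<in> zariski_closure (x_vars n) (X_set m E n p q).
                   \<not> liftable n (A_set m E n p q L) x} \<and>
         card {x \<in> zariski_closure (x_vars n) (X_set m E n p q).
                 \<not> liftable n (A_set m E n p q L) x}
           \<le> (\<Prod>i \<in> {1..n}. degree (lead_coeff (F i)))"
proof -
  let ?A = "A_set m E n p q L"
  let ?N = "{x \<in> zariski_closure (x_vars n) (X_set m E n p q). \<not> liftable n ?A x}"
  have F: "F i \<in> elim_ideal i (vanishing_ideal (td_vars m \<union> x_vars n) ?A)" if "i \<in> {1..n}" for i
    unfolding gen[OF that] by (auto intro: exI[of _ 1])
  have roots: "poly (lead_coeff (F i)) (x (XV i)) = 0" if "x \<in> ?N" "i \<in> {1..n}" for x i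
    using liftable_if_lead_coeff_nonzero[OF param lcm that(2) F[OF that(2)]] that(1) by blast
  have "lead_coeff (F i) \<noteq> 0" if "i \<in> {1..n}" for i
  proof -
    obtain G where "G \<noteq> 0" "G \<in> {F i * H | H. True}"
      using elim_ideal_nonzero[OF param lcm \<open>i \<in> {1..n}\<close>] gen[OF \<open>i \<in> {1..n}\<close>] by metis
    then show ?thesis by auto
  qed
  moreover have "?N \<subseteq> affine_space (x_vars n)"
    using zariski_closure_eq[of "X_set m E n p q" "x_vars n"] by (auto simp: X_set_def)
  ultimately have "finite ?N \<and> card ?N \<le> (\<Prod>i \<in> {1..n}. degree (lead_coeff (F i)))"
    using roots by (intro card_common_roots_le) auto
  then show ?thesis using roots by blast
qed

end
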